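(* Let $G$ be a connected graph of order $n$. Then $m(-1)=n-1$ if and only if $G\cong K_n$. In addition, $K_n$ is determined by its $\mathcal{A}$-spectrum.
   Context: For a connected graph $G$, $d(u,v)$ is the distance and $\varepsilon(v)=\max_u d(u,v)$ the eccentricity. The eccentricity matrix $\mathcal{A}(G)$ is indexed by $V(G)$ with $(u,v)$-entry $d(u,v)$ if $d(u,v)=\min\{\varepsilon(u),\varepsilon(v)\}$ and $0$ otherwise; its $\mathcal{A}$-spectrum is the multiset of its eigenvalues. $m(-1)$ is the multiplicity of $-1$ in the $\mathcal{A}$-spectrum. A graph $G$ is determined by its $\mathcal{A}$-spectrum if every connected graph with the same $\mathcal{A}$-spectrum as $G$ is isomorphic to $G$. *)

theory Defs
  imports
    "Graph_Theory.Graph_Theory"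
    "Jordan_Normal_Form.Char_Poly"
begin

text \<open>
  A finite simple graph is a \<open>pair_graph\<close> of the AFP entry Graph_Theory: a finite vertex set
  with a symmetric irreflexive relation, each edge being stored as two opposite arcs.
  The library's predicate \<open>Digraph_Component.connected\<close> includes non-emptiness of the vertex set.
  It is written qualified because of the topological notion of the same name.
\<close>

definition graph_dist :: "'a pair_pre_digraph \<Rightarrow> 'a \<Rightarrow> 'a \<Rightarrow> real" where
  "graph_dist G u v = real_of_ereal (wf_digraph.\<mu> (with_proj G) (\<lambda>_. 1) u v)"

definition eccentricity :: "'a pair_pre_digraph \<Rightarrow> 'a \<Rightarrow> real" where
  "eccentricity G v = Max (graph_dist G v ` pverts G)"

definition ecc_entry :: "'a pair_pre_digraph \<Rightarrow> 'a \<Rightarrow> 'a \<Rightarrow> real" where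
  "ecc_entry G u v =
     (if graph_dist G u v = min (eccentricity G u) (eccentricity G v)
      then graph_dist G u v else 0)"

text \<open>
  Matrices are indexed by numbers, so the eccentricity matrix is taken with respect to a listing
  of the vertices. Its spectrum does not depend on the listing; see \<open>ecc_spectrum_eq\<close> below.
\<close>

definition vertex_listing :: "'a pair_pre_digraph \<Rightarrow> 'a list \<Rightarrow> bool" where
  "vertex_listing G vs \<longleftrightarrow> distinct vs \<and> set vs = pverts G"

definition ecc_matrix :: "'a pair_pre_digraph \<Rightarrow> 'a list \<Rightarrow> real mat" where
  "ecc_matrix G vs =
     mat (length vs) (length vs) (\<lambda>(i, j). ecc_entry G (vs ! i) (vs ! j))"

text \<open>
  The eigenvalues are taken over the complex numbers, so that the multiset has as many elements
  as the graph has vertices by definition, without appeal to the symmetry of the matrix.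
\<close>

definition ecc_spectrum :: "'a pair_pre_digraph \<Rightarrow> complex multiset" where
  "ecc_spectrum G =
     proots (char_poly (map_mat complex_of_real (ecc_matrix G (SOME vs. vertex_listing G vs))))"

definition complete_graph :: "nat \<Rightarrow> nat pair_pre_digraph" where
  "complete_graph n = \<lparr> pverts = {0..<n}, parcs = {(i, j). i < n \<and> j < n \<and> i \<noteq> j} \<rparr>"

text \<open>
  The type argument is the vertex type of the graphs compared with \<open>G\<close>; a definition cannot
  quantify over it, so it is left to be generalized in theorems.
\<close>

definition determined_by_ecc_spectrum :: "'b itself \<Rightarrow> 'a pair_pre_digraph \<Rightarrow> bool" where
  "determined_by_ecc_spectrum (t :: 'b itself) G \<longleftrightarrow>
     (\<forall>H :: 'b pair_pre_digraph.
        pair_graph H \<and> Digraph_Component.connected (with_proj H) \<and>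
        ecc_spectrum H = ecc_spectrum G \<longrightarrow>
        digraph_iso (with_proj H) (with_proj G))"

lemma complete_digraph_complete_graph: "complete_digraph n (with_proj (complete_graph n))"
  unfolding complete_digraph_pair_def by (auto simp: complete_graph_def)

lemma digraph_iso_with_proj_iff:
  assumes "pair_wf_digraph G"
  shows "digraph_iso (with_proj G) (with_proj H) \<longleftrightarrow>
    (\<exists>f. inj_on f (pverts G) \<and> pverts H = f ` pverts G \<and> parcs H = map_prod f f ` parcs G)"
    (is "?L \<longleftrightarrow> ?R")
proof
  interpret pair_wf_digraph G by fact
  assume ?L
  then obtain h where h: "digraph_isomorphism h" "with_proj H = app_iso h (with_proj G)"
    unfolding digraph_iso_def by blast
  from h(2) have H: "pverts H = iso_verts h ` pverts G" "parcs H = iso_arcs h ` parcs G"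
    and th: "iso_tail h = fst" "iso_head h = snd"
    by (simp_all add: with_proj_def app_iso_def)
  have "iso_arcs h a = map_prod (iso_verts h) (iso_verts h) a" if "a \<in> parcs G" for a
    using h(1) that unfolding digraph_isomorphism_def
    by (auto simp: th prod_eq_iff)
  then have "parcs H = map_prod (iso_verts h) (iso_verts h) ` parcs G"
    unfolding H by (rule image_cong[OF refl])
  then show ?R
    using h(1) H(1) unfolding digraph_isomorphism_def by auto
next
  interpret pair_wf_digraph G by fact
  assume ?R
  then obtain f where f: "inj_on f (pverts G)" "pverts H = f ` pverts G"
      "parcs H = map_prod f f ` parcs G"
    by blast
  let ?h = "\<lparr> iso_verts = f, iso_arcs = map_prod f f, iso_head = snd, iso_tail = fst \<rparr>"
  have "inj_on (map_prod f f) (parcs G)"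
    using map_prod_inj_on[OF f(1) f(1)]
    by (rule inj_on_subset) (auto dest: in_arcsD1 in_arcsD2)
  then have "digraph_isomorphism ?h"
    using f(1) wf_digraph by (simp add: digraph_isomorphism_def)
  moreover have "with_proj H = app_iso ?h (with_proj G)"
    using f by (simp add: with_proj_def app_iso_def)
  ultimately show ?L
    unfolding digraph_iso_def by blast
qed

lemma graph_dist_eq_Least:
  assumes "pair_graph G" "Digraph_Component.connected (with_proj G)"
    and "u \<in> pverts G" "v \<in> pverts G"
  shows "graph_dist G u v =
    real (LEAST k. \<exists>p. pre_digraph.awalk (with_proj G) u p v \<and> length p = k)"
proof -
  interpret pair_graph G by fact
  have cost: "awalk_cost (\<lambda>_. 1) p = real (length p)" for p :: "('a \<times> 'a) list"
    by (induct p) (auto simp: awalk_cost_def)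
  have "u \<rightarrow>\<^sup>*\<^bsub>with_proj (mk_symmetric (with_proj G))\<^esub> v"
    using assms(2-4) by (simp add: Digraph_Component.connected_def strongly_connected_def)
  then have "u \<rightarrow>\<^sup>*\<^bsub>with_proj G\<^esub> v"
    using reachable_mk_symmetric_eq[OF sym_arcs] by simp
  then obtain p0 where p0: "awalk u p0 v"
    using reachable_awalk by blast
  define k where "k = (LEAST k. \<exists>p. awalk u p v \<and> length p = k)"
  have "\<exists>p. awalk u p v \<and> length p = k"
    unfolding k_def by (rule LeastI_ex) (use p0 in blast)
  then obtain q where q: "awalk u q v" "length q = k"
    by blast
  have le: "k \<le> length p" if "awalk u p v" for p
    unfolding k_def by (rule Least_le) (use that in blast)
  have "\<mu> (\<lambda>_. 1) u v = ereal (real k)"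
    unfolding \<mu>_def
    by (rule antisym[OF INF_lower2[of q] INF_greatest]) (use q le in \<open>auto simp: cost\<close>)
  then show ?thesis
    by (simp add: graph_dist_def k_def)
qed

lemma char_poly_reindex:
  fixes A :: "'c :: comm_ring_1 mat"
  assumes A: "A \<in> carrier_mat n n" and p: "p permutes {0..<n}"
  shows "char_poly (mat n n (\<lambda>(i, j). A $$ (p i, p j))) = char_poly A"
proof -
  let ?C = "char_poly_matrix A"
  have C: "?C \<in> carrier_mat n n" using A by simp
  have pn: "p i < n" if "i < n" for i using p that permutes_in_image[of p "{0..<n}" i] by simp
  let ?R = "mat n n (\<lambda>(i, j). ?C $$ (p i, j))"
  have R: "?R \<in> carrier_mat n n" by simp
  let ?T = "mat n n (\<lambda>(i, j). transpose_mat ?R $$ (p i, j))"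
  have inj: "p i = p j \<longleftrightarrow> i = j" for i j
    using permutes_inj[OF p] by (auto dest: injD)
  have "char_poly_matrix (mat n n (\<lambda>(i, j). A $$ (p i, p j))) = transpose_mat ?T"
    by (rule eq_matI) (use A pn inj in \<open>auto simp: char_poly_matrix_def\<close>)
  then have "char_poly (mat n n (\<lambda>(i, j). A $$ (p i, p j))) = det ?T"
    by (simp add: char_poly_def det_transpose[of _ n])
  also have "\<dots> = signof p * (signof p * det ?C)"
    using det_permute_rows[OF _ p, of "transpose_mat ?R"] det_permute_rows[OF C p]
      det_transpose[OF R] R by simp
  also have "\<dots> = det ?C"
    by (simp add: sign_def flip: mult.assoc)
  finally show ?thesis by (simp add: char_poly_def)
qed

lemma ecc_spectrum_eq:
  assumes "vertex_listing G vs"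
  shows "ecc_spectrum G = proots (char_poly (map_mat complex_of_real (ecc_matrix G vs)))"
proof -
  define ws where "ws = (SOME vs. vertex_listing G vs)"
  have ws: "vertex_listing G ws"
    unfolding ws_def using assms by (rule someI)
  have "mset ws = mset vs"
    using assms ws set_eq_iff_mset_eq_distinct[of ws vs] by (simp add: vertex_listing_def)
  then obtain p where p: "p permutes {..<length vs}" "permute_list p vs = ws"
    using mset_eq_permutation[of ws vs] by metis
  let ?n = "length vs"
  let ?A = "map_mat complex_of_real (ecc_matrix G vs)"
  have len: "length ws = ?n" using p by (metis length_permute_list)
  have p': "p permutes {0..<?n}" using p(1) by (simp add: lessThan_atLeast0)
  have pn: "p i < ?n" if "i < ?n" for i
    using p' that permutes_in_image[of p "{0..<?n}" i] by simp
  have "map_mat complex_of_real (ecc_matrix G ws) = mat ?n ?n (\<lambda>(i, j). ?A $$ (p i, p j))"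
    by (rule eq_matI)
      (use len p pn in \<open>auto simp: ecc_matrix_def permute_list_nth[symmetric]\<close>)
  then have "char_poly (map_mat complex_of_real (ecc_matrix G ws)) = char_poly ?A"
    using char_poly_reindex[OF _ p', of ?A] by (simp add: ecc_matrix_def)
  then show ?thesis
    by (simp add: ecc_spectrum_def ws_def)
qed

end

theory Submission
  imports
    Defs
    "Jordan_Normal_Form.Schur_Decomposition"
    "Jordan_Normal_Form.Jordan_Normal_Form_Uniqueness"
begin

section \<open>Triangularization and traces\<close>

text \<open>The eccentricity matrix A of a connected graph of order n > 0 is symmetric and
  nonnegative with zero diagonal, so its eigenvalues sum to 0. If -1 has multiplicity n - 1, the
  remaining eigenvalue is therefore n - 1, and a symmetric matrix with eigenvalues in {-1, n - 1}
  satisfies (A + 1)(A - (n - 1)) = 0. Conversely, this equation and the zero trace give back the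
  multiplicity (\<open>multiplicity_minus_one_iff\<close>).

  For B = A + 1 the equation reads B^2 = n B. As B has unit diagonal and nonnegative entries, this
  forces every entry of B to be 1 (\<open>char_matrix_product_eq_0_iff\<close>). So all off-diagonal
  entries of A are 1; a nonzero entry is a distance, hence distinct vertices are adjacent
  (\<open>clique_digraph_iff_ecc_entry\<close>).

  The number of eigenvalues is the order of the graph, so a graph cospectral with K_n has order n
  and the same multiplicity of -1, and the equivalence applies to it.

  Orthogonal diagonalization is avoided: a complex Schur form shows that the quadratic expression in
  A is nilpotent, and a real symmetric nilpotent matrix vanishes.\<close>

lemma complex_triangularization:
  fixes A :: "complex mat"
  assumes A: "A \<in> carrier_mat n n"
  obtains T P Q where "similar_mat_wit A T P Q" "upper_triangular T"
    "proots (char_poly A) = mset (diag_mat T)"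
proof -
  obtain es where es: "char_poly A = (\<Prod>a\<leftarrow>es. [:- a, 1:])"
    using char_poly_factorized[OF A] by blast
  obtain T P Q where "schur_decomposition A es = (T, P, Q)"
    by (cases "schur_decomposition A es") auto
  from schur_decomposition[OF A es this]
  have "similar_mat_wit A T P Q" "upper_triangular T" "diag_mat T = es"
    by auto
  moreover have "proots (\<Prod>a\<leftarrow>es. [:- a, 1:]) = mset es"
  proof (induction es)
    case (Cons a es)
    have "(\<Prod>a\<leftarrow>es. [:- a, 1:]) \<noteq> 0" by (auto simp: prod_list_zero_iff)
    then have "proots ([:- a, 1:] * (\<Prod>a\<leftarrow>es. [:- a, 1:])) =
        proots [:- a, 1:] + proots (\<Prod>a\<leftarrow>es. [:- a, 1:])"
      by (intro proots_mult) auto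
    with Cons show ?case by (simp del: mult_pCons_left)
  qed simp
  ultimately show thesis
    using that es by simp
qed

lemma trace_mult_comm:
  fixes A B :: "'a :: comm_semiring_0 mat"
  assumes "A \<in> carrier_mat n n" "B \<in> carrier_mat n n"
  shows "sum_list (diag_mat (A * B)) = sum_list (diag_mat (B * A))"
proof -
  have "sum_list (diag_mat (A * B)) = (\<Sum>i<n. \<Sum>j<n. A $$ (i, j) * B $$ (j, i))"
    using assms by (simp add: diag_mat_def interv_sum_list_conv_sum_set_nat lessThan_atLeast0
        scalar_prod_def)
  also have "\<dots> = (\<Sum>j<n. \<Sum>i<n. B $$ (j, i) * A $$ (i, j))"
    by (subst sum.swap) (simp add: mult.commute)
  also have "\<dots> = sum_list (diag_mat (B * A))"
    using assms by (simp add: diag_mat_def interv_sum_list_conv_sum_set_nat lessThan_atLeast0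
        scalar_prod_def)
  finally show ?thesis .
qed

text \<open>Cyclicity of the trace moves \<open>Q\<close> next to \<open>P\<close>, where they
  cancel.\<close>

lemma trace_similar:
  fixes A B :: "'a :: comm_ring_1 mat"
  assumes A: "A \<in> carrier_mat n n" and "similar_mat_wit A B P Q"
  shows "sum_list (diag_mat A) = sum_list (diag_mat B)"
proof -
  note w = similar_mat_witD2[OF A assms(2)]
  have "sum_list (diag_mat A) = sum_list (diag_mat (Q * (P * B)))"
    unfolding w(3) using w(5-7) by (intro trace_mult_comm[of _ n] mult_carrier_mat)
  also have "Q * (P * B) = B"
    unfolding assoc_mult_mat[OF w(7,6,5), symmetric] w(2) using w(5) by simp
  finally show ?thesis .
qed

text \<open>The two similarities must share \<open>P\<close> and \<open>Q\<close>, so that the inner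
  factor \<open>Q * P\<close> cancels. This carries the quadratic expression in a matrix over to its
  triangular form.\<close>

lemma similar_mat_wit_mult:
  fixes A A' B B' :: "'a :: comm_ring_1 mat"
  assumes A: "A \<in> carrier_mat n n" "A' \<in> carrier_mat n n"
    and "similar_mat_wit A B P Q" "similar_mat_wit A' B' P Q"
  shows "similar_mat_wit (A * A') (B * B') P Q"
proof -
  note w = similar_mat_witD2[OF A(1) assms(3)]
  note w' = similar_mat_witD2[OF A(2) assms(4)]
  note c = w(5-7) w'(5)
  have "A * A' = P * B * Q * (P * B' * Q)"
    unfolding w(3)[symmetric] w'(3)[symmetric] ..
  also have "\<dots> = P * B * (Q * P) * B' * Q"
    using c by (simp add: assoc_mult_mat[of _ n n _ n _ n] mult_carrier_mat[of _ n n _ n])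
  also have "\<dots> = P * (B * B') * Q"
    unfolding w(2) using c
    by (simp add: assoc_mult_mat[of _ n n _ n _ n] mult_carrier_mat[of _ n n _ n])
  finally show ?thesis
    using c A by (intro similar_mat_witI[OF w(1,2)] mult_carrier_mat)
qed

lemma upper_triangular_mult:
  fixes A B :: "'a :: semiring_0 mat"
  assumes "A \<in> carrier_mat n n" "B \<in> carrier_mat n n" "upper_triangular A" "upper_triangular B"
  shows "upper_triangular (A * B)"
    and "\<And>i. i < n \<Longrightarrow> (A * B) $$ (i, i) = A $$ (i, i) * B $$ (i, i)"
proof -
  have *: "A $$ (i, k) * B $$ (k, j) = 0" if "i < n" "k < n" "k < i \<or> j < k" for i j k
    using that assms upper_triangularD[of A k i] upper_triangularD[of B j k] by auto
  have entry: "(A * B) $$ (i, j) = (\<Sum>k\<in>{0..<n}. A $$ (i, k) * B $$ (k, j))"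
    if "i < n" "j < n" for i j
    using that assms by (simp add: scalar_prod_def)
  show "upper_triangular (A * B)"
  proof (rule upper_triangularI)
    fix i j assume "j < i" "i < dim_row (A * B)"
    with assms have "i < n" "j < n" by auto
    with \<open>j < i\<close> show "(A * B) $$ (i, j) = 0"
      unfolding entry[OF \<open>i < n\<close> \<open>j < n\<close>] by (intro sum.neutral ballI *) auto
  qed
  fix i assume i: "i < n"
  have "(\<Sum>k\<in>{0..<n}. A $$ (i, k) * B $$ (k, i)) = (\<Sum>k\<in>{i}. A $$ (i, k) * B $$ (k, i))"
    using i by (intro sum.mono_neutral_right ballI *) auto
  then show "(A * B) $$ (i, i) = A $$ (i, i) * B $$ (i, i)"
    using entry[OF i i] by simp
qed

lemma upper_triangular_char_matrix:
  assumes "T \<in> carrier_mat n n" "upper_triangular T"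
  shows "upper_triangular (char_matrix T e)"
    and "\<And>i. i < n \<Longrightarrow> char_matrix T e $$ (i, i) = T $$ (i, i) - e"
  using assms upper_triangularD[of T] by (auto simp: char_matrix_def intro!: upper_triangularI)

section \<open>Hollow symmetric matrices with the eigenvalue -1\<close>

lemma elements_if_count_and_sum_0:
  fixes M :: "complex multiset"
  assumes size: "size M = n" and "n > 0" and c: "count M (- 1) = n - 1" and s: "sum_mset M = 0"
  shows "set_mset M \<subseteq> {-1, of_nat n - 1}"
proof -
  have "replicate_mset (n - 1) (- 1) \<subseteq># M"
    using c by (simp add: count_le_replicate_mset_subset_eq[symmetric])
  then obtain N where N: "M = replicate_mset (n - 1) (- 1) + N"
    using mset_subset_eq_exists_conv by blast
  have "size N = 1" using size \<open>n > 0\<close> unfolding N by simp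
  then obtain x where x: "N = {#x#}" using size_1_singleton_mset by blast
  \<comment> \<open>The n - 1 copies of -1 contribute 1 - n to the zero sum.\<close>
  have "x = of_nat n - 1"
    using s \<open>n > 0\<close> unfolding N x by (simp add: of_nat_diff algebra_simps)
  then show ?thesis unfolding N x by auto
qed

lemma count_if_elements_and_sum_0:
  fixes M :: "complex multiset"
  assumes size: "size M = n" and "n > 0" and s: "sum_mset M = 0"
    and M: "set_mset M \<subseteq> {-1, of_nat n - 1}"
  shows "count M (- 1) = n - 1"
proof -
  \<comment> \<open>Raised by 1, each element is 0 or n, and it is 0 only for -1 since n > 0. For
    \<open>M\<close> the left side is n, so exactly one element differs from -1.\<close>
  have "sum_mset N + of_nat (size N) = of_nat n * of_nat (size N - count N (- 1))"
    if "set_mset N \<subseteq> {-1, of_nat n - 1}" for N :: "complex multiset"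
    using that
  proof (induction N)
    case (add x N)
    have "count N (- 1) \<le> size N" by (simp add: count_le_size)
    with add \<open>n > 0\<close> show ?case
      by (auto simp: Suc_diff_le algebra_simps)
  qed simp
  from this[OF M] have "(of_nat n :: complex) = of_nat n * of_nat (n - count M (- 1))"
    using size s by simp
  then have "n = n * (n - count M (- 1))"
    by (metis of_nat_eq_iff of_nat_mult)
  with \<open>n > 0\<close> show ?thesis by simp
qed

section \<open>Real symmetric matrices and the quadratic equation\<close>

lemma symmetric_trace_square_0:
  fixes C :: "real mat"
  assumes C: "C \<in> carrier_mat n n"
    and sym: "\<And>i j. i < n \<Longrightarrow> j < n \<Longrightarrow> C $$ (i, j) = C $$ (j, i)"
    and tr: "sum_list (diag_mat (C * C)) = 0"
  shows "C = 0\<^sub>m n n"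
proof -
  have "sum_list (diag_mat (C * C)) = (\<Sum>i<n. \<Sum>j<n. C $$ (i, j) * C $$ (j, i))"
    using C by (simp add: diag_mat_def interv_sum_list_conv_sum_set_nat lessThan_atLeast0
      scalar_prod_def)
  \<comment> \<open>By symmetry the trace of the square is the squared Frobenius norm.\<close>
  also have "\<dots> = (\<Sum>i<n. \<Sum>j<n. (C $$ (i, j))\<^sup>2)"
    by (intro sum.cong refl) (use sym in \<open>auto simp: power2_eq_square\<close>)
  finally have "C $$ (i, j) = 0" if "i < n" "j < n" for i j
    using that tr by (simp add: sum_nonneg_eq_0_iff sum_nonneg)
  then show ?thesis
    using C by (intro eq_matI) auto
qed

text \<open>Entrywise form of (A - a)(A - b) = (A - a)^2 + (a - b)(A - a), from A - b = (A - a) + (a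
  - b). For a = -1 and b = n - 1 it is B^2 - n B with B = A + 1.\<close>

lemma char_matrix_mult_entry:
  fixes A :: "'a :: field mat"
  assumes A: "A \<in> carrier_mat n n" and ij: "i < n" "j < n"
  shows "(char_matrix A a * char_matrix A b) $$ (i, j) =
    (\<Sum>k<n. char_matrix A a $$ (i, k) * char_matrix A a $$ (k, j)) +
    (a - b) * char_matrix A a $$ (i, j)"
proof -
  have ent: "char_matrix A b $$ (k, j) = char_matrix A a $$ (k, j) + (if k = j then a - b else 0)"
    if "k < n" for k
    using that A ij by (simp add: char_matrix_def)
  have "char_matrix A a \<in> carrier_mat n n" "char_matrix A b \<in> carrier_mat n n"
    using A by simp_all
  then have "(char_matrix A a * char_matrix A b) $$ (i, j) =
      (\<Sum>k<n. char_matrix A a $$ (i, k) * char_matrix A b $$ (k, j))"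
    using ij by (simp add: scalar_prod_def lessThan_atLeast0)
  also have "\<dots> = (\<Sum>k<n. char_matrix A a $$ (i, k) * char_matrix A a $$ (k, j) +
      (if k = j then (a - b) * char_matrix A a $$ (i, j) else 0))"
    by (intro sum.cong) (auto simp: ent algebra_simps)
  finally show ?thesis
    using ij by (simp add: sum.distrib)
qed

text \<open>
  With zero trace the remaining eigenvalue is \<open>n - 1\<close>, so \<open>C = (A + 1)(A - (n - 1))\<close> is nilpotent.
  As \<open>C\<close> is real symmetric, the trace of \<open>C * C\<close> is a sum of squares and \<open>C\<close> vanishes.
\<close>

lemma multiplicity_minus_one_iff:
  fixes A :: "real mat"
  assumes A: "A \<in> carrier_mat n n" and "n > 0"
    and sym: "\<And>i j. i < n \<Longrightarrow> j < n \<Longrightarrow> A $$ (i, j) = A $$ (j, i)"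
    and diag: "\<And>i. i < n \<Longrightarrow> A $$ (i, i) = 0"
  shows "count (proots (char_poly (map_mat complex_of_real A))) (- 1) = n - 1 \<longleftrightarrow>
    char_matrix A (- 1) * char_matrix A (real n - 1) = 0\<^sub>m n n"
proof -
  let ?A = "map_mat complex_of_real A"
  define M where "M = proots (char_poly ?A)"
  define C where "C = char_matrix A (- 1) * char_matrix A (real n - 1)"
  define D where "D = char_matrix ?A (- 1) * char_matrix ?A (of_nat n - 1)"
  have carr: "?A \<in> carrier_mat n n" using A by simp
  have C: "C \<in> carrier_mat n n" unfolding C_def using A by (intro mult_carrier_mat[of _ n n]) auto
  have "char_matrix ?A (complex_of_real e) = map_mat complex_of_real (char_matrix A e)" for e
    using A by (intro eq_matI) (auto simp: char_matrix_def)
  from this[of "-1"] this[of "real n - 1"] have D_C: "D = map_mat complex_of_real C"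
    unfolding C_def D_def using A
    by (simp add: of_real_hom.mat_hom_mult[of _ n n _ n])
  have sym': "char_matrix A (- 1) $$ (i, j) = char_matrix A (- 1) $$ (j, i)"
    if "i < n" "j < n" for i j
    using that A sym by (auto simp: char_matrix_def)
  \<comment> \<open>\<open>C\<close> is a polynomial in the symmetric matrix A + 1, hence symmetric
    although it is written as a product of two factors.\<close>
  have C_sym: "C $$ (i, j) = C $$ (j, i)" if ij: "i < n" "j < n" for i j
  proof -
    let ?B = "char_matrix A (- 1)"
    have "(\<Sum>k<n. ?B $$ (i, k) * ?B $$ (k, j)) = (\<Sum>k<n. ?B $$ (j, k) * ?B $$ (k, i))"
      using ij by (intro sum.cong) (simp_all add: sym'[of i] sym'[of _ j] mult.commute)
    then show ?thesis
      unfolding C_def char_matrix_mult_entry[OF A ij] char_matrix_mult_entry[OF A ij(2,1)]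
      using sym'[OF ij] by simp
  qed
  have D: "D \<in> carrier_mat n n" using C D_C by simp
  obtain T P Q where wit: "similar_mat_wit ?A T P Q" and T: "upper_triangular T"
      and M: "M = mset (diag_mat T)"
    using complex_triangularization[OF carr] unfolding M_def by metis
  have Tc: "T \<in> carrier_mat n n" using similar_mat_witD2[OF carr wit] by blast
  define E where "E = char_matrix T (- 1) * char_matrix T (of_nat n - 1)"
  have E: "E \<in> carrier_mat n n" unfolding E_def using Tc by (intro mult_carrier_mat[of _ n n]) auto
  have witE: "similar_mat_wit D E P Q"
    unfolding D_def E_def using carr
    by (intro similar_mat_wit_mult[of _ n] similar_mat_wit_char_matrix wit) auto
  note tri = upper_triangular_char_matrix[OF Tc T]
  have E_tri: "upper_triangular E"
    unfolding E_def using Tc by (intro upper_triangular_mult[of _ n] tri) auto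
  have E_diag: "E $$ (i, i) = (T $$ (i, i) + 1) * (T $$ (i, i) - (of_nat n - 1))" if "i < n" for i
    unfolding E_def using Tc that
    by (subst upper_triangular_mult(2)[of _ n]) (auto intro: tri simp: tri)
  have size: "size M = n" using Tc by (simp add: M diag_mat_def)
  have "sum_list (diag_mat ?A) = 0"
    using A diag by (simp add: diag_mat_def interv_sum_list_conv_sum_set_nat)
  then have tr: "sum_mset M = 0"
    using trace_similar[OF carr wit] by (simp add: M sum_mset_sum_list)
  have set_M: "set_mset M = (\<lambda>i. T $$ (i, i)) ` {..<n}"
    using Tc by (auto simp: M diag_mat_def)
  have "count M (- 1) = n - 1 \<longleftrightarrow> C = 0\<^sub>m n n"
  proof
    assume "count M (- 1) = n - 1"
    from elements_if_count_and_sum_0[OF size \<open>n > 0\<close> this tr]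
    have E0: "E $$ (i, i) = 0" if "i < n" for i
      using that by (auto simp: E_diag set_M)
    \<comment> \<open>The trace is computed in the triangular form, where the zero diagonal of
      \<open>E\<close> makes the diagonal of its square vanish.\<close>
    have "sum_list (diag_mat (D * D)) = sum_list (diag_mat (E * E))"
      by (rule trace_similar[OF _ similar_mat_wit_mult[OF D D witE witE]]) (use D in auto)
    also have "\<dots> = (\<Sum>i<n. (E * E) $$ (i, i))"
      using E by (simp add: diag_mat_def interv_sum_list_conv_sum_set_nat lessThan_atLeast0)
    also have "\<dots> = 0"
      by (intro sum.neutral ballI) (simp add: upper_triangular_mult(2)[OF E E E_tri E_tri] E0)
    finally have "sum_list (diag_mat (D * D)) = 0" .
    moreover have "sum_list (diag_mat (D * D)) = complex_of_real (sum_list (diag_mat (C * C)))"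
      using C by (simp add: D_C diag_mat_def interv_sum_list_conv_sum_set_nat scalar_prod_def)
    ultimately have "sum_list (diag_mat (C * C)) = 0" by simp
    then show "C = 0\<^sub>m n n"
      by (intro symmetric_trace_square_0 C C_sym)
  next
    assume "C = 0\<^sub>m n n"
    then have "D = 0\<^sub>m n n" by (auto simp: D_C)
    \<comment> \<open>Reversing the similarity transports the vanishing to \<open>E\<close>, whose
      diagonal consists of the values of (x + 1)(x - (n - 1)) at the eigenvalues.\<close>
    moreover have "E = Q * D * P"
      using similar_mat_witD2[OF E similar_mat_wit_sym[OF witE]] by blast
    ultimately have "E = 0\<^sub>m n n"
      using similar_mat_witD2(6,7)[OF D witE] by simp
    then have "T $$ (i, i) = -1 \<or> T $$ (i, i) = of_nat n - 1" if "i < n" for i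
      using E_diag[OF that] that by (auto simp: eq_neg_iff_add_eq_0)
    then show "count M (- 1) = n - 1"
      by (intro count_if_elements_and_sum_0 size tr \<open>n > 0\<close>) (auto simp: set_M)
  qed
  then show ?thesis by (simp add: M_def C_def)
qed

text \<open>
  The product vanishes iff \<open>B * B = n B\<close> for \<open>B = A + 1\<close>, that is, iff \<open>n b\<^sub>i\<^sub>j\<close> is the inner product
  of the rows \<open>i\<close> and \<open>j\<close>. On the diagonal all rows then have squared norm \<open>n\<close>, so the entries
  are at most \<open>1\<close> in absolute value, and each row attains its norm only with entries \<open>\<plusminus>1\<close>.
\<close>

lemma char_matrix_product_eq_0_iff:
  fixes A :: "real mat"
  assumes A: "A \<in> carrier_mat n n" and "n > 0"
    and sym: "\<And>i j. i < n \<Longrightarrow> j < n \<Longrightarrow> A $$ (i, j) = A $$ (j, i)"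
    and diag: "\<And>i. i < n \<Longrightarrow> A $$ (i, i) = 0"
    and nonneg: "\<And>i j. i < n \<Longrightarrow> j < n \<Longrightarrow> A $$ (i, j) \<ge> 0"
  shows "char_matrix A (- 1) * char_matrix A (real n - 1) = 0\<^sub>m n n \<longleftrightarrow>
    (\<forall>i<n. \<forall>j<n. A $$ (i, j) = (if i = j then 0 else 1))"
proof
  let ?B = "char_matrix A (- 1)"
  have B: "?B $$ (i, j) = A $$ (i, j) + (if i = j then 1 else 0)" if "i < n" "j < n" for i j
    using that A by (simp add: char_matrix_def)
  have B_sym: "?B $$ (i, j) = ?B $$ (j, i)" if "i < n" "j < n" for i j
    using that sym by (simp add: B)
  assume "?B * char_matrix A (real n - 1) = 0\<^sub>m n n"
  then have prod: "real n * ?B $$ (i, j) = (\<Sum>k<n. ?B $$ (i, k) * ?B $$ (k, j))"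
    if "i < n" "j < n" for i j
    using char_matrix_mult_entry[OF A that, of "-1" "real n - 1"] that by simp
  have norm: "(\<Sum>k<n. (?B $$ (i, k))\<^sup>2) = real n" if "i < n" for i
  proof -
    have "(\<Sum>k<n. (?B $$ (i, k))\<^sup>2) = (\<Sum>k<n. ?B $$ (i, k) * ?B $$ (k, i))"
      using that by (intro sum.cong) (auto simp: power2_eq_square B_sym[of _ i])
    then show ?thesis using prod[OF that that] that diag by (simp add: B)
  qed
  have le: "(?B $$ (i, j))\<^sup>2 \<le> 1" if ij: "i < n" "j < n" for i j
  proof -
    \<comment> \<open>The inequality 2xy \<le> x^2 + y^2 serves as Cauchy-Schwarz, because both rows
      have squared norm n.\<close>
    have "real n * ?B $$ (i, j) \<le> (\<Sum>k<n. ((?B $$ (i, k))\<^sup>2 + (?B $$ (j, k))\<^sup>2) / 2)"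
      unfolding prod[OF ij]
    proof (rule sum_mono)
      fix k assume "k \<in> {..<n}"
      then have "?B $$ (k, j) = ?B $$ (j, k)" using B_sym ij by simp
      then show "?B $$ (i, k) * ?B $$ (k, j) \<le> ((?B $$ (i, k))\<^sup>2 + (?B $$ (j, k))\<^sup>2) / 2"
        using sum_squares_bound[of "?B $$ (i, k)" "?B $$ (j, k)"] by simp
    qed
    also have "\<dots> = real n"
      using ij by (simp add: norm sum.distrib flip: sum_divide_distrib)
    finally have "?B $$ (i, j) \<le> 1" using \<open>n > 0\<close> by simp
    moreover have "?B $$ (i, j) \<ge> 0" using nonneg ij by (simp add: B)
    ultimately show ?thesis by (simp add: power_le_one)
  qed
  have one: "?B $$ (i, j) = 1" if ij: "i < n" "j < n" for i j
  proof -
    have "(\<Sum>k<n. 1 - (?B $$ (i, k))\<^sup>2) = 0"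
      using norm[OF ij(1)] by (simp add: sum_subtractf)
    then have "(?B $$ (i, j))\<^sup>2 = 1"
      using le ij by (subst (asm) sum_nonneg_eq_0_iff) auto
    moreover have "?B $$ (i, j) \<ge> 0" using nonneg ij by (simp add: B)
    ultimately show ?thesis by (simp add: power2_eq_1_iff)
  qed
  show "\<forall>i<n. \<forall>j<n. A $$ (i, j) = (if i = j then 0 else 1)"
  proof (intro allI impI)
    fix i j assume "i < n" "j < n"
    then show "A $$ (i, j) = (if i = j then 0 else 1)"
      using B[of i j] one[of i j] by auto
  qed
next
  assume "\<forall>i<n. \<forall>j<n. A $$ (i, j) = (if i = j then 0 else 1)"
  then have B: "char_matrix A (- 1) $$ (i, j) = 1" if "i < n" "j < n" for i j
    using that A by (simp add: char_matrix_def)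
  have "(char_matrix A (- 1) * char_matrix A (real n - 1)) $$ (i, j) = 0"
    if "i < n" "j < n" for i j
    unfolding char_matrix_mult_entry[OF A that] using that by (simp add: B)
  moreover have "char_matrix A (- 1) * char_matrix A (real n - 1) \<in> carrier_mat n n"
    using A by (intro mult_carrier_mat[of _ n n]) auto
  ultimately show "char_matrix A (- 1) * char_matrix A (real n - 1) = 0\<^sub>m n n"
    by (intro eq_matI) auto
qed

section \<open>Complete graphs\<close>

text \<open>Completeness without reference to an isomorphism, for any vertex type: the middle term
  between the spectral condition and isomorphism with \<open>complete_graph n\<close>.\<close>

definition clique_digraph :: "'a pair_pre_digraph \<Rightarrow> bool" where
  "clique_digraph G \<longleftrightarrow> parcs G = {(u, v). u \<in> pverts G \<and> v \<in> pverts G \<and> u \<noteq> v}"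

lemma (in pair_graph) arc_imp_neq: "(u, v) \<in> parcs G \<Longrightarrow> u \<noteq> v"
  using no_loops[of "(u, v)"] by simp

section \<open>Distances and eccentricity entries\<close>

lemma graph_dist_sym:
  assumes G: "pair_graph G" "Digraph_Component.connected (with_proj G)"
    and uv: "u \<in> pverts G" "v \<in> pverts G"
  shows "graph_dist G u v = graph_dist G v u"
proof -
  interpret pair_graph G by fact
  \<comment> \<open>Reversing a walk keeps its length, so both distances are minima over the same
    set of lengths.\<close>
  have rev: "awalk v (rev (map prod.swap p)) u" if "awalk u p v" for u p v
    using that
  proof (induction p arbitrary: u)
    case (Cons e p)
    then have e: "e \<in> parcs G" "fst e = u" and p: "awalk (snd e) p v"
      by (auto simp: awalk_Cons_iff)
    have "(snd e, fst e) \<in> parcs G"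
      using e sym_arcs by (auto simp: symmetric_def arcs_ends_def sym_def arc_to_ends_def)
    then have "awalk (snd e) [prod.swap e] u"
      using e by (auto simp: awalk_Cons_iff awalk_Nil_iff prod.swap_def dest: in_arcsD2)
    with Cons.IH[OF p] show ?case by (auto simp: awalk_append_iff)
  qed (simp add: awalk_Nil_iff)
  then have "(\<exists>p. awalk u p v \<and> length p = k) \<longleftrightarrow> (\<exists>p. awalk v p u \<and> length p = k)" for k
    by (metis length_map length_rev)
  then show ?thesis
    using graph_dist_eq_Least[OF G uv] graph_dist_eq_Least[OF G uv(2,1)] by simp
qed

lemma graph_dist_cases:
  assumes G: "pair_graph G" "Digraph_Component.connected (with_proj G)"
    and uv: "u \<in> pverts G" "v \<in> pverts G"
  shows "graph_dist G u v \<ge> 0"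
    and "graph_dist G u v = 0 \<longleftrightarrow> u = v"
    and "graph_dist G u v = 1 \<longleftrightarrow> (u, v) \<in> parcs G"
proof -
  interpret pair_graph G by fact
  define P where "P k \<longleftrightarrow> (\<exists>p. awalk u p v \<and> length p = k)" for k
  have dist: "graph_dist G u v = real (LEAST k. P k)"
    using graph_dist_eq_Least[OF G uv] by (simp add: P_def)
  have "u \<rightarrow>\<^sup>*\<^bsub>with_proj (mk_symmetric (with_proj G))\<^esub> v"
    using G uv by (simp add: Digraph_Component.connected_def strongly_connected_def)
  then have "\<exists>k. P k"
    unfolding P_def using reachable_mk_symmetric_eq[OF sym_arcs] by (simp add: reachable_awalk)
  then have P: "P (LEAST k. P k)" by (rule LeastI_ex)
  have P0: "P 0 \<longleftrightarrow> u = v"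
    using uv by (auto simp: P_def awalk_Nil_iff)
  have P1: "P 1 \<longleftrightarrow> (u, v) \<in> parcs G"
    using uv by (auto simp: P_def awalk_Cons_iff awalk_Nil_iff length_Suc_conv intro!: exI[of _ "[(u, v)]"])
  show "graph_dist G u v \<ge> 0" by (simp add: dist)
  show "graph_dist G u v = 0 \<longleftrightarrow> u = v"
    using P P0 by (auto simp: dist)
  show "graph_dist G u v = 1 \<longleftrightarrow> (u, v) \<in> parcs G"
  proof
    assume "graph_dist G u v = 1"
    then show "(u, v) \<in> parcs G" using P P1 by (simp add: dist)
  next
    assume uv: "(u, v) \<in> parcs G"
    then have "\<not> P 0" using P0 arc_imp_neq by auto
    have "(LEAST k. P k) = 1"
    proof (rule Least_equality)
      show "1 \<le> k" if "P k" for k using that \<open>\<not> P 0\<close> by (cases k) auto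
    qed (use uv P1 in simp)
    then show "graph_dist G u v = 1" by (simp add: dist)
  qed
qed

lemma clique_digraph_iff_ecc_entry:
  assumes G: "pair_graph G" "Digraph_Component.connected (with_proj G)"
  shows "clique_digraph G \<longleftrightarrow>
    (\<forall>u\<in>pverts G. \<forall>v\<in>pverts G. ecc_entry G u v = (if u = v then 0 else 1))"
proof
  interpret pair_graph G by fact
  assume "clique_digraph G"
  then have d: "graph_dist G u v = (if u = v then 0 else 1)"
    if "u \<in> pverts G" "v \<in> pverts G" for u v
    using that graph_dist_cases[OF G that] by (auto simp: clique_digraph_def)
  \<comment> \<open>This takes a second vertex \<open>v\<close>; a lone vertex has eccentricity 0.
    Diagonal entries are 0 in either case, since the distance itself is 0.\<close>
  have ecc: "eccentricity G u = 1"
    if "u \<in> pverts G" "v \<in> pverts G" "u \<noteq> v" for u v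
    unfolding eccentricity_def using that d by (intro Max_eqI) (auto intro!: image_eqI[of _ _ v])
  show "\<forall>u\<in>pverts G. \<forall>v\<in>pverts G. ecc_entry G u v = (if u = v then 0 else 1)"
    using d ecc by (auto simp: ecc_entry_def)
next
  interpret pair_graph G by fact
  assume e: "\<forall>u\<in>pverts G. \<forall>v\<in>pverts G. ecc_entry G u v = (if u = v then 0 else 1)"
  have "(u, v) \<in> parcs G" if "u \<in> pverts G" "v \<in> pverts G" "u \<noteq> v" for u v
  proof -
    have "ecc_entry G u v = 1" using e that by simp
    then have "graph_dist G u v = 1" unfolding ecc_entry_def by (metis zero_neq_one)
    then show ?thesis using graph_dist_cases(3)[OF G that(1,2)] by simp
  qed
  then show "clique_digraph G"
    by (auto simp: clique_digraph_def dest: arc_imp_neq in_arcsD1 in_arcsD2)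
qed

section \<open>Complete graphs up to isomorphism\<close>

lemma digraph_iso_complete_graph_iff:
  assumes "pair_graph G" "card (pverts G) = n"
  shows "digraph_iso (with_proj G) (with_proj (complete_graph n)) \<longleftrightarrow> clique_digraph G"
proof -
  interpret pair_graph G by fact
  have "(\<exists>f. inj_on f (pverts G) \<and> {0..<n} = f ` pverts G \<and>
      {(i, j). i < n \<and> j < n \<and> i \<noteq> j} = map_prod f f ` parcs G) \<longleftrightarrow> clique_digraph G"
    (is "(\<exists>f. ?iso f) \<longleftrightarrow> _")
  proof
    assume "\<exists>f. ?iso f"
    then obtain f where f: "inj_on f (pverts G)" "{0..<n} = f ` pverts G"
      "{(i, j). i < n \<and> j < n \<and> i \<noteq> j} = map_prod f f ` parcs G" by blast
    have "(u, v) \<in> parcs G" if uv: "u \<in> pverts G" "v \<in> pverts G" "u \<noteq> v" for u v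
    proof -
      have "f u \<in> {0..<n}" "f v \<in> {0..<n}" "f u \<noteq> f v"
        using uv f(1) unfolding f(2) by (auto dest: inj_onD)
      then have "(f u, f v) \<in> map_prod f f ` parcs G" unfolding f(3)[symmetric] by simp
      then obtain x y where "(x, y) \<in> parcs G" "f u = f x" "f v = f y" by auto
      moreover from this have "x \<in> pverts G" "y \<in> pverts G" by (auto dest: in_arcsD1 in_arcsD2)
      ultimately show ?thesis using uv f(1) by (metis inj_onD)
    qed
    then show "clique_digraph G"
      by (auto simp: clique_digraph_def dest: arc_imp_neq in_arcsD1 in_arcsD2)
  next
    assume c: "clique_digraph G"
    \<comment> \<open>Any bijection of the vertices is an isomorphism between cliques.\<close>
    obtain f where f: "bij_betw f (pverts G) {0..<n}"
      using ex_bij_betw_finite_nat[OF finite_verts] assms(2) by auto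
    have im: "f u < n" if "u \<in> pverts G" for u
      using bij_betwE[OF f] that by auto
    have "map_prod f f ` parcs G = {(i, j). i < n \<and> j < n \<and> i \<noteq> j}"
    proof (intro equalityI subsetI)
      fix x assume "x \<in> map_prod f f ` parcs G"
      then show "x \<in> {(i, j). i < n \<and> j < n \<and> i \<noteq> j}"
        using c im bij_betw_imp_inj_on[OF f] by (auto simp: clique_digraph_def dest: inj_onD)
    next
      fix x assume "x \<in> {(i, j). i < n \<and> j < n \<and> i \<noteq> j}"
      then obtain i j where x: "x = (i, j)" "i < n" "j < n" "i \<noteq> j" by auto
      then have "i \<in> f ` pverts G" "j \<in> f ` pverts G"
        using bij_betw_imp_surj_on[OF f] by auto
      with x c show "x \<in> map_prod f f ` parcs G"
        by (auto simp: clique_digraph_def image_iff)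
    qed
    then show "\<exists>f. ?iso f"
      using f by (intro exI[of _ f]) (auto simp: bij_betw_def)
  qed
  then show ?thesis
    using digraph_iso_with_proj_iff[of G "complete_graph n"] pair_wf_digraph_axioms
    by (simp add: complete_graph_def)
qed

lemma ecc_entry_sym:
  assumes "pair_graph G" "Digraph_Component.connected (with_proj G)"
    and "u \<in> pverts G" "v \<in> pverts G"
  shows "ecc_entry G u v = ecc_entry G v u"
  using graph_dist_sym[OF assms] by (simp add: ecc_entry_def min.commute)

lemma pair_graph_complete_graph: "pair_graph (complete_graph n)"
  by unfold_locales
    (auto simp: complete_graph_def symmetric_def arcs_ends_def arc_to_ends_def intro!: symI
      intro: finite_subset[of _ "{0..<n} \<times> {0..<n}"])

lemma connected_complete_graph:
  assumes "n > 0"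
  shows "Digraph_Component.connected (with_proj (complete_graph n))"
proof -
  interpret pair_graph "complete_graph n" by (rule pair_graph_complete_graph)
  have "u \<rightarrow>\<^sup>*\<^bsub>with_proj (complete_graph n)\<^esub> v"
    if "u \<in> pverts (complete_graph n)" "v \<in> pverts (complete_graph n)" for u v
  proof (cases "u = v")
    case False
    with that have "(u, v) \<in> parcs (complete_graph n)" by (auto simp: complete_graph_def)
    then show ?thesis by (intro reachable_adjI) (auto simp: arcs_ends_def arc_to_ends_def)
  qed (use that in auto)
  then show ?thesis
    using assms reachable_mk_symmetric_eq[OF sym_arcs]
    by (auto simp: Digraph_Component.connected_def strongly_connected_def complete_graph_def)
qed

section \<open>From the spectrum to completeness\<close>

lemma size_ecc_spectrum:
  assumes "finite (pverts G)"
  shows "size (ecc_spectrum G) = card (pverts G)"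
proof -
  obtain vs where vs: "distinct vs" "set vs = pverts G"
    using finite_distinct_list[OF assms] by blast
  let ?A = "map_mat complex_of_real (ecc_matrix G vs)"
  have "?A \<in> carrier_mat (length vs) (length vs)" by (simp add: ecc_matrix_def)
  then have "degree (char_poly ?A) = card (pverts G)"
    using degree_monic_char_poly distinct_card[OF vs(1)] vs(2) by metis
  then show ?thesis
    using vs by (simp add: ecc_spectrum_eq[of G vs] vertex_listing_def size_proots_complex)
qed

lemma count_ecc_spectrum_minus_one:
  assumes G: "pair_graph G" "Digraph_Component.connected (with_proj G)"
    and n: "card (pverts G) = n"
  shows "count (ecc_spectrum G) (- 1) = n - 1 \<longleftrightarrow> clique_digraph G"
proof -
  interpret pair_graph G by fact
  obtain vs where vs: "distinct vs" "set vs = pverts G"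
    using finite_distinct_list[OF finite_verts] by auto
  then have listing: "vertex_listing G vs" by (simp add: vertex_listing_def)
  have len: "length vs = n" using distinct_card[OF vs(1)] vs(2) n by simp
  have "pverts G \<noteq> {}"
    using G by (auto simp: Digraph_Component.connected_def strongly_connected_def)
  then have "n > 0" using n finite_verts by (auto simp: card_gt_0_iff)
  have in_G: "vs ! i \<in> pverts G" if "i < n" for i
    using that vs(2) len by (metis nth_mem)
  have ent: "ecc_matrix G vs $$ (i, j) = ecc_entry G (vs ! i) (vs ! j)" if "i < n" "j < n" for i j
    using that len by (simp add: ecc_matrix_def)
  have A: "ecc_matrix G vs \<in> carrier_mat n n" by (simp add: ecc_matrix_def len)
  have sym: "ecc_matrix G vs $$ (i, j) = ecc_matrix G vs $$ (j, i)" if "i < n" "j < n" for i j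
    using that ecc_entry_sym[OF G] in_G by (simp add: ent)
  have diag: "ecc_matrix G vs $$ (i, i) = 0" if "i < n" for i
    using that graph_dist_cases(2)[OF G in_G[OF that] in_G[OF that]] by (simp add: ent ecc_entry_def)
  have nonneg: "ecc_matrix G vs $$ (i, j) \<ge> 0" if "i < n" "j < n" for i j
    unfolding ent[OF that] ecc_entry_def
    using graph_dist_cases(1)[OF G in_G[OF that(1)] in_G[OF that(2)]] by (metis order_refl)
  have "count (ecc_spectrum G) (- 1) = n - 1 \<longleftrightarrow>
      char_matrix (ecc_matrix G vs) (- 1) * char_matrix (ecc_matrix G vs) (real n - 1) = 0\<^sub>m n n"
    unfolding ecc_spectrum_eq[OF listing]
    by (rule multiplicity_minus_one_iff[OF A \<open>n > 0\<close>]) (erule (1) sym, erule diag)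
  also have "\<dots> \<longleftrightarrow> (\<forall>i<n. \<forall>j<n. ecc_matrix G vs $$ (i, j) = (if i = j then 0 else 1))"
    by (rule char_matrix_product_eq_0_iff[OF A \<open>n > 0\<close>]) (erule (1) sym, erule diag, erule (1) nonneg)
  \<comment> \<open>As the listing is distinct, equality of indices is equality of vertices, and the
    condition becomes one on the graph alone.\<close>
  also have "\<dots> \<longleftrightarrow>
      (\<forall>i<n. \<forall>j<n. ecc_entry G (vs ! i) (vs ! j) = (if vs ! i = vs ! j then 0 else 1))"
    by (intro all_cong1 imp_cong refl) (simp add: ent nth_eq_iff_index_eq[OF vs(1)] len)
  also have "\<dots> \<longleftrightarrow>
      (\<forall>u\<in>pverts G. \<forall>v\<in>pverts G. ecc_entry G u v = (if u = v then 0 else 1))"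
    unfolding vs(2)[symmetric] all_set_conv_all_nth len ..
  finally show ?thesis
    unfolding clique_digraph_iff_ecc_entry[OF G] .
qed

theorem theorem3p1:
  fixes G :: "'a pair_pre_digraph" and n :: nat
  assumes "pair_graph G"
    and "Digraph_Component.connected (with_proj G)"
    and "card (pverts G) = n"
  shows "(count (ecc_spectrum G) (- 1) = n - 1 \<longleftrightarrow>
            digraph_iso (with_proj G) (with_proj (complete_graph n))) \<and>
         determined_by_ecc_spectrum TYPE('b) (complete_graph n)"
proof
  show "count (ecc_spectrum G) (- 1) = n - 1 \<longleftrightarrow>
      digraph_iso (with_proj G) (with_proj (complete_graph n))"
    using count_ecc_spectrum_minus_one[OF assms] digraph_iso_complete_graph_iff[OF assms(1,3)]
    by simp
  interpret pair_graph G by fact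
  have "pverts G \<noteq> {}"
    using assms by (auto simp: Digraph_Component.connected_def strongly_connected_def)
  then have "n > 0" using assms(3) finite_verts by (auto simp: card_gt_0_iff)
  have card: "card (pverts (complete_graph n)) = n" by (simp add: complete_graph_def)
  have "clique_digraph (complete_graph n)"
    by (auto simp: clique_digraph_def complete_graph_def)
  then have K: "count (ecc_spectrum (complete_graph n)) (- 1) = n - 1"
    using count_ecc_spectrum_minus_one[OF pair_graph_complete_graph
      connected_complete_graph[OF \<open>n > 0\<close>] card] by simp
  show "determined_by_ecc_spectrum TYPE('b) (complete_graph n)"
    unfolding determined_by_ecc_spectrum_def
  proof (intro allI impI, elim conjE)
    fix H :: "'b pair_pre_digraph"
    assume H: "pair_graph H" "Digraph_Component.connected (with_proj H)"
      and spec: "ecc_spectrum H = ecc_spectrum (complete_graph n)"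
    interpret H: pair_graph H by fact
    \<comment> \<open>Equality of the multisets includes their sizes, which are the orders; only
      then does the multiplicity n - 1 characterize completeness of \<open>H\<close>.\<close>
    have "card (pverts H) = n"
      using size_ecc_spectrum[of H] H.finite_verts size_ecc_spectrum[of "complete_graph n"] spec card
      by (simp add: complete_graph_def)
    then show "digraph_iso (with_proj H) (with_proj (complete_graph n))"
      using count_ecc_spectrum_minus_one[OF H] digraph_iso_complete_graph_iff[OF H(1)] K spec
      by simp
  qed
qed

end
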